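(* Let $q\ge1$ and let $A:\mathbb C\to M_q(\mathbb C)$ be entire, with $A(0)=0$, and suppose $$\|e^{A(z)}\|\le C e^{\tau|z|}\qquad(z\in\mathbb C)$$ for constants $C\ge1$ and $\tau\ge0$, where $\|\cdot\|$ is an operator norm. Then $z\mapsto\sigma_k(A(z))$ is a polynomial of degree at most $k$ for $1\le k\le q$. If, in addition, $A(z)=zH+O(z^2)$ as $z\to0$ for some $H\in M_q(\mathbb C)$, then $$\det(\zeta I-A(z))=\det(\zeta I-zH)$$ for all $z,\zeta\in\mathbb C$. Consequently, $$\operatorname{tr}(A(z)^p)=z^p\operatorname{tr}(H^p)\qquad(p\ge1,\ z\in\mathbb C).$$
   Context: For $B\in M_q(\mathbb C)$, $\sigma_k(B)$ is the $k$th elementary symmetric function of the eigenvalues of $B$ counted with algebraic multiplicity, so $\det(\zeta I-B)=\zeta^q-\sigma_1(B)\zeta^{q-1}+\cdots+(-1)^q\sigma_q(B)$, where $I=I_q$. *)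

theory Defs
  imports "HOL-Analysis.Analysis" "HOL-Computational_Algebra.Fundamental_Theorem_Algebra"
    "HOL-Library.Landau_Symbols"
begin

text \<open>The space $M_q(\mathbb{C})$ is \<^typ>\<open>complex^'q^'q\<close> with $q = $ \<^term>\<open>CARD('q)\<close>, which is
  positive for every index type. The scalar matrix $\zeta I$ is \<^term>\<open>mat \<zeta>\<close>, so that $zH$ is
  \<^term>\<open>mat z ** H\<close>. The product \<^term>\<open>A * B\<close> and the power \<^term>\<open>A ^ k\<close> of this type are
  entrywise, hence the separate matrix power below.\<close>

primrec matpow :: "complex^'q^'q \<Rightarrow> nat \<Rightarrow> complex^'q^'q" where
  "matpow B 0 = mat 1"
| "matpow B (Suc k) = B ** matpow B k"

definition matexp :: "complex^'q^'q \<Rightarrow> complex^'q^'q" where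
  "matexp B = (\<Sum>k. matpow B k /\<^sub>R fact k)"

definition is_vnorm :: "(complex^'q \<Rightarrow> real) \<Rightarrow> bool" where
  "is_vnorm N \<longleftrightarrow>
     (\<forall>v. N v = 0 \<longleftrightarrow> v = 0) \<and>
     (\<forall>c v. N (c *s v) = norm c * N v) \<and>
     (\<forall>v w. N (v + w) \<le> N v + N w)"

text \<open>The operator norm induced by the vector norm \<^term>\<open>N\<close>, on the pattern of \<^const>\<open>onorm\<close>:
  the term for $v = 0$ is $0/0 = 0$ and does not affect the supremum.\<close>

definition opnorm :: "(complex^'q \<Rightarrow> real) \<Rightarrow> complex^'q^'q \<Rightarrow> real" where
  "opnorm N B = (SUP v. N (B *v v) / N v)"

definition charpoly :: "complex^'q^'q \<Rightarrow> complex poly" where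
  "charpoly B = det (\<chi> i j. (if i = j then [:0, 1:] else 0) - [:B $ i $ j:])"

definition eigvals :: "complex^'q^'q \<Rightarrow> complex multiset" where
  "eigvals B = proots (charpoly B)"

text \<open>The elementary symmetric function of a multiset \<^term>\<open>M\<close>: its elements, counted with
  multiplicity, are indexed by the pairs \<open>(x, i)\<close> with \<open>i < count M x\<close>.\<close>

definition mset_index :: "'a multiset \<Rightarrow> ('a \<times> nat) set" where
  "mset_index M = {(x, i). i < count M x}"

definition elem_sym :: "nat \<Rightarrow> 'a::comm_ring_1 multiset \<Rightarrow> 'a" where
  "elem_sym k M = (\<Sum>S | S \<subseteq> mset_index M \<and> card S = k. \<Prod>s\<in>S. fst s)"

definition eig_sigma :: "nat \<Rightarrow> complex^'q^'q \<Rightarrow> complex" where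
  "eig_sigma k B = elem_sym k (eigvals B)"

subsection \<open>Convergence of the exponential series\<close>

lemma norm_matrix_mult_le:
  fixes A B :: "complex^'q^'q"
  shows "norm (A ** B) \<le> (real CARD('q) ^ 3) * norm A * norm B"
proof -
  have entry: "norm ((A ** B) $ i $ j) \<le> real CARD('q) * (norm A * norm B)" for i j
  proof -
    have "norm ((A ** B) $ i $ j) \<le> (\<Sum>k\<in>UNIV. norm (A $ i $ k * B $ k $ j))"
      unfolding matrix_matrix_mult_def by (simp add: norm_sum)
    also have "\<dots> \<le> (\<Sum>k\<in>(UNIV::'q set). norm A * norm B)"
    proof (rule sum_mono)
      fix k
      have "norm (A $ i $ k) \<le> norm A"
        using Finite_Cartesian_Product.norm_nth_le[of "A $ i" k]
          Finite_Cartesian_Product.norm_nth_le[of A i] by linarith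
      moreover have "norm (B $ k $ j) \<le> norm B"
        using Finite_Cartesian_Product.norm_nth_le[of "B $ k" j]
          Finite_Cartesian_Product.norm_nth_le[of B k] by linarith
      ultimately show "norm (A $ i $ k * B $ k $ j) \<le> norm A * norm B"
        by (simp add: norm_mult mult_mono)
    qed
    finally show ?thesis by simp
  qed
  have "norm (A ** B) \<le> (\<Sum>i\<in>UNIV. norm ((A ** B) $ i))"
    by (simp add: L2_set_le_sum norm_vec_def)
  also have "\<dots> \<le> (\<Sum>i\<in>UNIV. \<Sum>j\<in>UNIV. norm ((A ** B) $ i $ j))"
    by (intro sum_mono) (simp add: L2_set_le_sum norm_vec_def)
  also have "\<dots> \<le> (\<Sum>i\<in>(UNIV::'q set). \<Sum>j\<in>(UNIV::'q set). real CARD('q) * (norm A * norm B))"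
    by (intro sum_mono entry)
  finally show ?thesis by (simp add: power3_eq_cube mult.assoc)
qed

lemma summable_matexp: "summable (\<lambda>k. matpow (B :: complex^'q^'q) k /\<^sub>R fact k)"
proof -
  define c where "c = real CARD('q) ^ 3 * norm B"
  have c0: "c \<ge> 0" by (simp add: c_def)
  have bd: "norm (matpow B k) \<le> norm (mat 1 :: complex^'q^'q) * c ^ k" for k
  proof (induction k)
    case (Suc k)
    have "norm (matpow B (Suc k)) \<le> c * norm (matpow B k)"
      unfolding c_def matpow.simps by (rule norm_matrix_mult_le)
    also have "\<dots> \<le> c * (norm (mat 1 :: complex^'q^'q) * c ^ k)"
      using Suc c0 by (rule mult_left_mono)
    finally show ?case by (simp add: algebra_simps)
  qed simp
  have "summable (\<lambda>k. norm (mat 1 :: complex^'q^'q) * (c ^ k /\<^sub>R fact k))"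
    by (intro summable_mult summable_exp_generic)
  then show ?thesis
  proof (rule summable_comparison_test'[where N = 0])
    fix k
    show "norm (matpow B k /\<^sub>R fact k) \<le> norm (mat 1 :: complex^'q^'q) * (c ^ k /\<^sub>R fact k)"
      using bd[of k] by (simp add: field_simps)
  qed
qed

subsection \<open>The characteristic polynomial and the functions \<open>\<sigma>\<^sub>k\<close>\<close>

lemma poly_charpoly: "poly (charpoly B) \<zeta> = det (mat \<zeta> - B)"
proof -
  have "poly (of_int n) \<zeta> = (of_int n :: complex)" for n :: int
    by (metis of_int_poly poly_const_conv)
  then show ?thesis
    unfolding charpoly_def det_def
    by (auto simp: poly_sum poly_prod mat_def if_distrib[of "\<lambda>p. poly p \<zeta>"]
        intro!: sum.cong arg_cong2[where f = "(*)"] prod.cong)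
qed

lemma
  fixes B :: "complex^'q^'q"
  shows degree_charpoly: "degree (charpoly B) = CARD('q)"
    and monic_charpoly: "lead_coeff (charpoly B) = 1"
proof -
  let ?e = "\<lambda>i j. (if i = j then [:0, 1:] else 0) - [:B $ i $ j:]"
  let ?t = "\<lambda>p. of_int (sign p) * (\<Prod>i\<in>UNIV. ?e i (p i))"
  let ?P = "{p. p permutes (UNIV :: 'q set)}"
  have diag: "?t id = (\<Prod>i\<in>UNIV. [:- B $ i $ i, 1:])"
    by (simp add: sign_id)
  have deg1: "degree (?t id) = CARD('q)"
    unfolding diag by (subst degree_prod_eq_sum_degree) auto
  have lc1: "lead_coeff (?t id) = 1"
    unfolding diag lead_coeff_prod by simp
  have off: "degree (?t p) < CARD('q)" if p: "p \<in> ?P - {id}" for p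
  proof -
    obtain i0 where i0: "p i0 \<noteq> i0" using p by (metis DiffD2 eq_id_iff singletonI)
    have "degree (?t p) \<le> degree (\<Prod>i\<in>UNIV. ?e i (p i))"
      by (rule order_trans[OF degree_mult_le]) (simp add: of_int_poly)
    also have "\<dots> \<le> (\<Sum>i\<in>UNIV. degree (?e i (p i)))"
      using degree_prod_sum_le[of UNIV "\<lambda>i. ?e i (p i)"] by (simp add: o_def)
    also have "\<dots> < (\<Sum>i\<in>(UNIV::'q set). 1)"
    proof (rule sum_strict_mono_ex1)
      show "\<forall>i\<in>UNIV. degree (?e i (p i)) \<le> 1" by auto
      show "\<exists>i\<in>UNIV. degree (?e i (p i)) < 1" using i0 by (intro bexI[of _ i0]) auto
    qed simp
    finally show ?thesis by simp
  qed
  have split: "charpoly B = ?t id + (\<Sum>p\<in>?P - {id}. ?t p)"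
    unfolding charpoly_def det_def
    by (subst sum.remove[of _ id]) (auto simp: permutes_id intro!: sum.cong)
  have rest: "degree (\<Sum>p\<in>?P - {id}. ?t p) < degree (?t id)"
    unfolding deg1 by (rule degree_sum_less) (use off in auto)
  show d: "degree (charpoly B) = CARD('q)"
    unfolding split using degree_add_eq_left[OF rest] deg1 by simp
  show "lead_coeff (charpoly B) = 1"
    unfolding split using lead_coeff_add_le[of "(\<Sum>p\<in>?P - {id}. ?t p)" "?t id"] rest lc1
    by (simp add: add.commute)
qed

lemma finite_mset_index: "finite (mset_index M)"
proof -
  have "mset_index M = (SIGMA x:set_mset M. {..<count M x})"
    by (auto simp: mset_index_def count_inI)
  then show ?thesis by simp
qed

lemma prod_mset_index:
  fixes f :: "'a \<Rightarrow> 'b::comm_monoid_mult"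
  shows "(\<Prod>x\<in>#M. f x) = (\<Prod>s\<in>mset_index M. f (fst s))"
proof -
  have "mset_index M = (SIGMA x:set_mset M. {..<count M x})"
    by (auto simp: mset_index_def count_inI)
  then have "(\<Prod>s\<in>mset_index M. f (fst s)) = (\<Prod>x\<in>set_mset M. f x ^ count M x)"
    using prod.Sigma[of "set_mset M" "\<lambda>x. {..<count M x}" "\<lambda>x _. f x", symmetric]
    by (simp add: split_beta)
  then show ?thesis by (simp add: image_prod_mset_multiplicity)
qed

lemma det_eq_sum_eig_sigma:
  fixes B :: "complex^'q^'q"
  shows "det (mat \<zeta> - B) = (\<Sum>k\<le>CARD('q). (-1) ^ k * eig_sigma k B * \<zeta> ^ (CARD('q) - k))"
proof -
  let ?I = "mset_index (eigvals B)"
  have fin: "finite ?I" by (rule finite_mset_index)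
  have cardI: "card ?I = CARD('q)"
  proof -
    have "?I = (SIGMA x:set_mset (eigvals B). {..<count (eigvals B) x})"
      by (auto simp: mset_index_def count_inI)
    then have "card ?I = size (eigvals B)"
      by (simp add: card_SigmaI size_multiset_overloaded_eq)
    then show ?thesis
      by (simp add: eigvals_def size_proots_complex degree_charpoly)
  qed
  have "charpoly B = (\<Prod>x\<in>#eigvals B. [:-x, 1:])"
    using complex_poly_decompose_multiset[of "charpoly B"]
    by (simp add: eigvals_def monic_charpoly)
  then have "charpoly B = (\<Prod>s\<in>?I. [:- fst s, 1:])"
    by (simp add: prod_mset_index)
  then have "det (mat \<zeta> - B) = (\<Prod>s\<in>?I. \<zeta> - fst s)"
    by (simp flip: poly_charpoly add: poly_prod)
  also have "\<dots> = (\<Sum>S\<in>Pow ?I. (-1) ^ card S * (\<Prod>s\<in>S. fst s) * (\<Prod>s\<in>?I - S. \<zeta>))"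
    by (rule prod_diff_conv_sum[OF fin])
  also have "\<dots> = (\<Sum>S\<in>Pow ?I. (-1) ^ card S * (\<Prod>s\<in>S. fst s) * \<zeta> ^ (CARD('q) - card S))"
    using fin by (intro sum.cong) (auto simp: card_Diff_subset finite_subset cardI)
  also have "\<dots> = (\<Sum>k\<le>CARD('q). \<Sum>S | S \<in> Pow ?I \<and> card S = k.
                   (-1) ^ card S * (\<Prod>s\<in>S. fst s) * \<zeta> ^ (CARD('q) - card S))"
    using fin card_mono[OF fin] by (intro sum.group[symmetric]) (auto simp: cardI)
  also have "\<dots> = (\<Sum>k\<le>CARD('q). (-1) ^ k * eig_sigma k B * \<zeta> ^ (CARD('q) - k))"
    by (intro sum.cong refl)
       (auto simp: eig_sigma_def elem_sym_def sum_distrib_left sum_distrib_right intro!: sum.cong)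
  finally show ?thesis .
qed

end

theory Submission
  imports Defs "HOL-Complex_Analysis.Complex_Analysis"
begin

text \<open>Eigenvectors show that every eigenvalue \<open>\<mu>\<close> of \<open>A(z)\<close> satisfies \<open>Re \<mu> \<le> ln C + \<tau> |z|\<close>. For \<open>c\<close> of
  order \<open>1 + R\<close> the function \<open>det (c I - A(z)) / c\<^sup>q\<close> is therefore bounded away from \<open>0\<close> on the disc
  of radius \<open>R\<close>, and equals \<open>1\<close> at \<open>0\<close>; the Borel-Caratheodory argument for its logarithm bounds it on
  the half disc. Hence the eigenvalues grow at most linearly, \<open>\<sigma>\<^sub>k(A(z)) = O((1 + |z|)\<^sup>k)\<close>, and Liouville's
  theorem applies. If \<open>A(z) = z H + O(z\<^sup>2)\<close>, then \<open>\<sigma>\<^sub>k(A(z)) / z\<^sup>k = \<sigma>\<^sub>k(A(z) / z)\<close> tends to \<open>\<sigma>\<^sub>k(H)\<close>,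
  which forces the polynomial \<open>\<sigma>\<^sub>k(A(z))\<close> to be \<open>\<sigma>\<^sub>k(H) z\<^sup>k\<close>. The traces of powers are determined by the
  characteristic polynomial: with \<open>r\<^sub>i\<close> the roots of \<open>X\<^sup>p - c\<close>, the matrix \<open>B\<^sup>p - c I\<close> is the product of
  the \<open>B - r\<^sub>i I\<close>.\<close>

subsection \<open>Eigenvalues and operator norms\<close>

lemma det_mat: "det (mat c :: 'a::comm_ring_1^'n^'n) = c ^ CARD('n)"
  by (subst det_diagonal) (auto simp: mat_def)

lemma mat_vector_mult: "mat c *v v = c *s (v :: 'a::comm_ring_1^'n)"
  by (simp add: vec_eq_iff matrix_vector_mult_def mat_def if_distrib if_distribR cong: if_cong)

lemma mat_matrix_mult_nth: "(mat c ** M) $ i $ j = c * (M $ i $ j :: 'a::comm_ring_1)"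
  by (simp add: matrix_matrix_mult_def mat_def if_distrib if_distribR cong: if_cong)

lemma matrix_mat_mult_nth: "(M ** mat c) $ i $ j = (M $ i $ j :: 'a::comm_ring_1) * c"
  by (simp add: matrix_matrix_mult_def mat_def if_distrib if_distribR cong: if_cong)

lemma eigvals_iff: "\<mu> \<in># eigvals B \<longleftrightarrow> det (mat \<mu> - B) = 0"
proof -
  have "charpoly B \<noteq> 0"
    using monic_charpoly[of B] by auto
  then show ?thesis by (simp add: eigvals_def poly_charpoly)
qed

lemma size_eigvals: "size (eigvals (B :: complex^'q^'q)) = CARD('q)"
  by (simp add: eigvals_def size_proots_complex degree_charpoly)

lemma det_eq_prod_eigvals: "det (mat \<zeta> - B) = (\<Prod>\<mu>\<in>#eigvals B. \<zeta> - \<mu>)"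
proof -
  have "charpoly B = (\<Prod>x\<in>#eigvals B. [:-x, 1:])"
    using complex_poly_decompose_multiset[of "charpoly B"]
    by (simp add: eigvals_def monic_charpoly)
  then show ?thesis
    by (simp flip: poly_charpoly add: poly_prod_mset)
qed

lemma eigenvector_exists:
  assumes "\<mu> \<in># eigvals B"
  obtains v where "v \<noteq> 0" "B *v v = \<mu> *s v"
proof -
  have "\<not> invertible (mat \<mu> - B)"
    using assms by (simp add: eigvals_iff invertible_det_nz)
  then have "\<not> (\<exists>C. C ** (mat \<mu> - B) = mat 1)"
    using invertible_left_inverse by blast
  then obtain v where "(mat \<mu> - B) *v v = 0" "v \<noteq> 0"
    by (auto simp: matrix_left_invertible_ker)
  then show ?thesis
    using that by (simp add: matrix_vector_mult_diff_rdistrib mat_vector_mult)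
qed

lemma matexp_eigenvector:
  fixes B :: "complex^'q^'q"
  assumes "B *v v = \<mu> *s v"
  shows "matexp B *v v = exp \<mu> *s v"
proof -
  have pow: "matpow B k *v v = \<mu> ^ k *s v" for k
    by (induction k)
      (simp_all add: matrix_vector_mul_assoc[symmetric] vec.scale assms vec.scale_scale mult.commute)
  have bl: "bounded_linear (\<lambda>M :: complex^'q^'q. M *v v)"
    by (intro linear_conv_bounded_linear[THEN iffD1] linearI)
      (simp_all add: vec_eq_iff matrix_vector_mult_def algebra_simps sum.distrib scaleR_sum_right)
  have bl2: "bounded_linear (\<lambda>c. c *s v)"
    by (intro linear_conv_bounded_linear[THEN iffD1] linearI)
      (simp_all add: vec_eq_iff algebra_simps)
  have "matexp B *v v = (\<Sum>k. (matpow B k /\<^sub>R fact k) *v v)"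
    unfolding matexp_def by (rule bounded_linear.suminf[OF bl summable_matexp])
  also have "\<dots> = (\<Sum>k. (\<mu> ^ k /\<^sub>R fact k) *s v)"
  proof (rule arg_cong[where f = suminf], rule ext)
    fix k
    have "(matpow B k /\<^sub>R fact k) *v v = (matpow B k *v v) /\<^sub>R fact k"
      by (rule linear_cmul[OF bounded_linear.linear[OF bl]])
    also have "\<dots> = (\<mu> ^ k /\<^sub>R fact k) *s v"
      by (simp add: pow vec_eq_iff)
    finally show "(matpow B k /\<^sub>R fact k) *v v = (\<mu> ^ k /\<^sub>R fact k) *s v" .
  qed
  also have "\<dots> = exp \<mu> *s v"
    unfolding exp_def by (rule bounded_linear.suminf[OF bl2 summable_exp_generic, symmetric])
  finally show ?thesis .
qed

section \<open>Comparison of an arbitrary vector norm with the Euclidean one\<close>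

lemma is_vnormD:
  assumes "is_vnorm N"
  shows "N v = 0 \<longleftrightarrow> v = 0" "N (c *s v) = norm c * N v" "N (v + w) \<le> N v + N w"
  using assms by (auto simp: is_vnorm_def)

lemma is_vnorm_nonneg:
  assumes "is_vnorm N" shows "N v \<ge> 0"
proof -
  have "N (v + (-1) *s v) \<le> N v + N ((-1) *s v)"
    by (rule is_vnormD[OF assms])
  moreover have "v + (-1) *s v = 0" by (simp add: vec_eq_iff)
  ultimately show ?thesis
    using is_vnormD(1)[OF assms, of 0] is_vnormD(2)[OF assms, of "-1" v] by simp
qed

lemma is_vnorm_le_norm:
  assumes "is_vnorm N"
  obtains M where "M \<ge> 0" "\<And>v. N v \<le> M * norm v"
proof
  let ?M = "\<Sum>i\<in>UNIV. N (axis i 1)"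
  show "?M \<ge> 0" by (intro sum_nonneg is_vnorm_nonneg[OF assms])
  fix v
  have sumle: "N (\<Sum>i\<in>I. f i) \<le> (\<Sum>i\<in>I. N (f i))" if "finite I" for I and f :: "'a \<Rightarrow> complex^'a"
    using that
  proof induction
    case empty
    then show ?case using is_vnormD(1)[OF assms, of 0] by simp
  next
    case (insert i I)
    then show ?case using is_vnormD(3)[OF assms, of "f i" "sum f I"] by simp
  qed
  have "N v = N (\<Sum>i\<in>UNIV. (v $ i) *s axis i 1)" by (simp add: basis_expansion)
  also have "\<dots> \<le> (\<Sum>i\<in>UNIV. N ((v $ i) *s axis i 1))" by (rule sumle) simp
  also have "\<dots> \<le> (\<Sum>i\<in>UNIV. norm v * N (axis i 1))"
    by (intro sum_mono)
      (auto simp: is_vnormD(2)[OF assms] Finite_Cartesian_Product.norm_nth_le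
        intro!: mult_right_mono is_vnorm_nonneg[OF assms])
  finally show "N v \<le> ?M * norm v" by (simp add: sum_distrib_left mult.commute)
qed

text \<open>The upper bound from \<open>is_vnorm_le_norm\<close> makes \<open>N\<close> Lipschitz,
  so \<open>N\<close> attains its minimum on the compact Euclidean unit sphere. The minimum is
  positive, and homogeneity carries the bound to all vectors.\<close>

lemma is_vnorm_ge_norm:
  fixes N :: "complex^'q \<Rightarrow> real"
  assumes "is_vnorm N"
  obtains c where "c > 0" "\<And>v. c * norm v \<le> N v"
proof -
  obtain M where M: "M \<ge> 0" "\<And>v. N v \<le> M * norm v" using is_vnorm_le_norm[OF assms] by blast
  have diff: "N v - N w \<le> M * dist v w" for v w
    using is_vnormD(3)[OF assms, of "v - w" w] M(2)[of "v - w"] by (simp add: dist_norm)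
  have "M-lipschitz_on UNIV N"
  proof (rule lipschitz_onI)
    show "dist (N v) (N w) \<le> M * dist v w" for v w
      using diff[of v w] diff[of w v] by (simp add: dist_real_def dist_commute abs_le_iff)
  qed (rule M)
  then have cont: "continuous_on (sphere 0 1) N"
    by (meson lipschitz_on_continuous_on lipschitz_on_subset subset_UNIV)
  have ne: "sphere (0 :: complex^'q) 1 \<noteq> {}" by simp
  obtain u where u: "u \<in> sphere 0 1" "\<And>v. v \<in> sphere 0 1 \<Longrightarrow> N u \<le> N v"
    using continuous_attains_inf[OF compact_sphere ne cont] by blast
  have "u \<noteq> 0" using u(1) by auto
  then have pos: "N u > 0"
    using is_vnormD(1)[OF assms, of u] is_vnorm_nonneg[OF assms, of u] by linarith
  show ?thesis
  proof (rule that[OF pos])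
    fix v
    show "N u * norm v \<le> N v"
    proof (cases "v = 0")
      case True
      then show ?thesis using is_vnorm_nonneg[OF assms, of v] by simp
    next
      case False
      define w where "w = v /\<^sub>R norm v"
      \<comment> \<open>The normalisation is a real scaling, whereas \<open>is_vnorm\<close>
        concerns complex scalars; this identity translates between the two.\<close>
      have "w $ i = v $ i / of_real (norm v)" for i
        unfolding w_def vector_scaleR_component by (simp add: scaleR_conv_of_real divide_inverse)
      then have v: "v = complex_of_real (norm v) *s w"
        using False by (simp add: vec_eq_iff)
      have "N u \<le> N w" using False by (intro u(2)) (simp add: w_def)
      then have "N u * norm v \<le> norm v * N w" by (metis mult.commute mult_right_mono norm_ge_zero)
      also have "\<dots> = N v"
        using arg_cong[OF v, of N] is_vnormD(2)[OF assms, of "of_real (norm v)" w] by simp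
      finally show ?thesis .
    qed
  qed
qed

text \<open>A real supremum dominates its terms only once the quotients are known to be bounded
  above. The equivalence of \<open>N\<close> with the Euclidean norm and the boundedness of
  \<open>B\<close> as a linear map supply that bound.\<close>

lemma opnorm_upper:
  fixes N :: "complex^'q \<Rightarrow> real"
  assumes "is_vnorm N"
  shows "N (B *v v) / N v \<le> opnorm N B"
proof -
  obtain M where M: "M \<ge> 0" "\<And>v. N v \<le> M * norm v" using is_vnorm_le_norm[OF assms] by blast
  obtain c where c: "c > 0" "\<And>v. c * norm v \<le> N v" using is_vnorm_ge_norm[OF assms] by blast
  obtain K where K: "K > 0" "\<And>v. norm (B *v v) \<le> norm v * K"
    using bounded_linear.pos_bounded[of "(*v) B"] by auto
  have "N (B *v v) / N v \<le> M * K / c" for v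
  proof (cases "v = 0")
    case True
    then show ?thesis using M(1) K(1) c(1) is_vnormD(1)[OF assms, of 0] by simp
  next
    case False
    then have "N v > 0"
      using is_vnormD(1)[OF assms, of v] is_vnorm_nonneg[OF assms, of v] by linarith
    moreover have "N (B *v v) \<le> M * K / c * N v"
    proof -
      have "N (B *v v) \<le> M * norm (B *v v)" by (rule M)
      also have "\<dots> \<le> M * (norm v * K)" using K(2) M(1) by (intro mult_left_mono) auto
      also have "\<dots> = M * K / c * (c * norm v)" using c(1) by simp
      also have "\<dots> \<le> M * K / c * N v" using c M(1) K(1) by (intro mult_left_mono) auto
      finally show ?thesis .
    qed
    ultimately show ?thesis by (simp add: divide_le_eq)
  qed
  then have "bdd_above (range (\<lambda>v. N (B *v v) / N v))" by (auto intro!: bdd_aboveI)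
  then show ?thesis unfolding opnorm_def by (rule cSUP_upper[OF UNIV_I])
qed

text \<open>An eigenvector of \<open>B\<close> for \<mu> is one of \<open>matexp B\<close> for
  \<open>exp \<mu>\<close>, whose modulus is \<open>exp (Re \<mu>)\<close>. So a bound on the
  exponential controls the eigenvalues of \<open>B\<close> on one side only, through their real
  parts.\<close>

lemma exp_Re_eigval_le_opnorm_matexp:
  assumes "is_vnorm N" "\<mu> \<in># eigvals B"
  shows "exp (Re \<mu>) \<le> opnorm N (matexp B)"
proof -
  obtain v where v: "v \<noteq> 0" "B *v v = \<mu> *s v" using eigenvector_exists[OF assms(2)] .
  have "N v \<noteq> 0" using v(1) is_vnormD(1)[OF assms(1)] by simp
  then have "exp (Re \<mu>) = N (matexp B *v v) / N v"
    by (simp add: matexp_eigenvector[OF v(2)] is_vnormD(2)[OF assms(1)])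
  then show ?thesis using opnorm_upper[OF assms(1), of "matexp B" v] by simp
qed

subsection \<open>Growth of the eigenvalues\<close>

text \<open>The logarithm of \<^term>\<open>g\<close> has real part above \<^term>\<open>ln b\<close>; a Moebius map sends that half-plane
  to the unit disc, where the Schwarz lemma applies.\<close>

lemma nonvanishing_holomorphic_bound:
  fixes g :: "complex \<Rightarrow> complex"
  assumes hol: "g holomorphic_on ball 0 R" and g0: "g 0 = 1" and R: "R > 0"
    and b: "b > 0" and low: "\<And>w. w \<in> ball 0 R \<Longrightarrow> b < norm (g w)"
    and z: "norm z \<le> R / 2"
  shows "norm (g z) \<le> 1 / b ^ 2"
proof -
  have "g w \<noteq> 0" if "w \<in> ball 0 R" for w using low[OF that] b by auto
  then obtain l where l: "l holomorphic_on ball 0 R" "\<And>w. w \<in> ball 0 R \<Longrightarrow> exp (l w) = g w"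
    using holomorphic_logarithm_exists[OF _ _ hol, of 0] R by auto
  define a where "a = - ln b"
  define F where "F w = l (of_real R * w) - l 0" for w
  have in_ball: "of_real R * w \<in> ball 0 R" if "norm w < 1" for w :: complex
    using that R by (simp add: norm_mult)
  \<comment> \<open>Since \<open>g 0 = 1\<close>, also \<open>exp (l 0) = 1\<close>, so subtracting
    \<open>l 0\<close> normalises the logarithm at the origin without changing its
    exponential.\<close>
  have expF: "exp (F w) = g (of_real R * w)" if "norm w < 1" for w
    using l(2)[OF in_ball[OF that]] l(2)[of 0] R g0 by (simp add: F_def exp_diff)
  have ReF: "Re (F w) > - a" if w: "norm w < 1" for w
  proof -
    have "exp (- a) < exp (Re (F w))"
      using low[OF in_ball[OF w]] b by (simp add: a_def flip: expF[OF w])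
    then show ?thesis by simp
  qed
  have F0: "F 0 = 0" by (simp add: F_def)
  \<comment> \<open>At the origin \<open>F\<close> vanishes, so the strict lower bound there says
    \<open>-a < 0\<close>.\<close>
  have a: "a > 0" using ReF[of 0] F0 by simp
  define h where "h w = F w / (2 * of_real a + F w)" for w
  have less: "norm (F w) < norm (2 * of_real a + F w)" if "norm w < 1" for w
  proof -
    \<comment> \<open>This quantity is exactly the difference of the two squared moduli compared
      next.\<close>
    have "0 < 4 * a * (a + Re (F w))" using a ReF[OF that] by simp
    then have "(norm (F w))\<^sup>2 < (norm (2 * of_real a + F w))\<^sup>2"
      unfolding cmod_power2 by (simp add: power2_eq_square algebra_simps)
    then show ?thesis by (rule power2_less_imp_less) simp
  qed
  have nz: "2 * of_real a + F w \<noteq> 0" if "norm w < 1" for w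
    using less[OF that] by auto
  have "F holomorphic_on ball 0 1"
    unfolding F_def
    by (intro holomorphic_intros holomorphic_on_compose_gen[OF _ l(1), unfolded o_def])
      (use in_ball in auto)
  then have holh: "h holomorphic_on ball 0 1"
    unfolding h_def using nz by (intro holomorphic_intros) auto
  have h1: "norm (h w) < 1" if "norm w < 1" for w
    using less[OF that] nz[OF that] by (simp add: h_def norm_divide)
  define w where "w = z / of_real R"
  have w: "norm w \<le> 1 / 2" using z R by (simp add: w_def norm_divide field_simps)
  then have w1: "norm w < 1" by simp
  have "norm (h w) \<le> norm w"
    by (rule Schwarz_Lemma(1)[OF holh _ h1 w1]) (simp_all add: h_def F0)
  then have "norm (F w) \<le> norm w * norm (2 * of_real a + F w)"
    using nz[OF w1] by (simp add: h_def norm_divide divide_le_eq)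
  \<comment> \<open>The factor \<open>1 / 2\<close> from the half disc lets the term
    \<open>norm (F w)\<close> on the right be absorbed on the left.\<close>
  also have "\<dots> \<le> 1 / 2 * (2 * a + norm (F w))"
    using w a by (intro mult_mono order_trans[OF norm_triangle_ineq]) auto
  finally have "norm (F w) \<le> 2 * a" by simp
  have "norm (g z) = exp (Re (F w))"
    using R expF[OF w1] by (simp add: w_def flip: norm_exp_eq_Re)
  also have "\<dots> \<le> exp (2 * a)"
    using \<open>norm (F w) \<le> 2 * a\<close> complex_Re_le_cmod[of "F w"] by simp
  also have "\<dots> = 1 / b ^ 2"
    using b by (simp add: a_def exp_minus exp_double power_one_over inverse_eq_divide)
  finally show ?thesis .
qed

section \<open>Regularity of the coefficients of the characteristic polynomial\<close>

text \<open>The coefficients are polynomial expressions in the entries, so they inherit any property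
  stable under sums and products. Used once with holomorphy and once with continuity.\<close>

lemma charpoly_coeff_closed:
  fixes P :: "('b \<Rightarrow> complex) \<Rightarrow> bool" and A :: "'b \<Rightarrow> complex^'q^'q"
  assumes const: "\<And>c. P (\<lambda>_. c)"
    and add: "\<And>f g. P f \<Longrightarrow> P g \<Longrightarrow> P (\<lambda>x. f x + g x)"
    and mult: "\<And>f g. P f \<Longrightarrow> P g \<Longrightarrow> P (\<lambda>x. f x * g x)"
    and entries: "\<And>i j. P (\<lambda>x. A x $ i $ j)"
  shows "P (\<lambda>x. coeff (charpoly (A x)) n)"
proof -
  have P_sum: "P (\<lambda>x. \<Sum>i\<in>I. f i x)" if "\<And>i. i \<in> I \<Longrightarrow> P (f i)" for I and f :: "'i \<Rightarrow> 'b \<Rightarrow> complex"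
    using that by (induction I rule: infinite_finite_induct) (auto intro: const add)
  \<comment> \<open>\<open>P\<close> is lifted coefficientwise to polynomial-valued functions; the
    convolution formula for products keeps the lifted property stable, so the determinant can be
    treated as a whole.\<close>
  define Q where "Q p \<longleftrightarrow> (\<forall>n. P (\<lambda>x. coeff (p x) n))" for p :: "'b \<Rightarrow> complex poly"
  have Q_const: "Q (\<lambda>_. p)" for p by (simp add: Q_def const)
  have Q_mult: "Q (\<lambda>x. p x * r x)" if "Q p" "Q r" for p r
    using that by (auto simp: Q_def coeff_mult intro!: P_sum mult)
  have Q_prod: "Q (\<lambda>x. \<Prod>i\<in>I. p i x)" if "\<And>i. i \<in> I \<Longrightarrow> Q (p i)" for I and p :: "'i \<Rightarrow> 'b \<Rightarrow> complex poly"
    using that by (induction I rule: infinite_finite_induct) (auto intro: Q_const Q_mult)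
  have Q_sum: "Q (\<lambda>x. \<Sum>i\<in>I. p i x)" if "\<And>i. i \<in> I \<Longrightarrow> Q (p i)" for I and p :: "'i \<Rightarrow> 'b \<Rightarrow> complex poly"
    using that by (auto simp: Q_def coeff_sum intro!: P_sum)
  have Q_entry: "Q (\<lambda>x. (if i = j then [:0, 1:] else 0) - [:A x $ i $ j:])" for i j
  proof -
    have "P (\<lambda>x. coeff ((if i = j then [:0, 1:] else 0) - [:A x $ i $ j:]) n)" for n
    proof (cases n)
      case 0
      have "P (\<lambda>x. (-1) * A x $ i $ j)" by (intro mult const entries)
      then have "P (\<lambda>x. - A x $ i $ j)" by simp
      then show ?thesis using 0 by (cases "i = j") auto
    next
      case (Suc m)
      then show ?thesis using const by simp
    qed
    then show ?thesis by (simp add: Q_def)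
  qed
  have "Q (\<lambda>x. charpoly (A x))"
    unfolding charpoly_def det_def vec_lambda_beta
    by (intro Q_sum Q_mult Q_const Q_prod Q_entry)
  then show ?thesis by (simp add: Q_def)
qed

text \<open>The definition through eigenvalues shows no regular dependence on the matrix, whereas a
  coefficient does. The expansion \<open>det_eq_sum_eig_sigma\<close> is compared with
  \<open>charpoly B\<close> at every point.\<close>

lemma eig_sigma_eq_coeff_charpoly:
  fixes B :: "complex^'q^'q"
  assumes "k \<le> CARD('q)"
  shows "eig_sigma k B = (-1) ^ k * coeff (charpoly B) (CARD('q) - k)"
proof -
  let ?q = "CARD('q)"
  let ?p = "\<Sum>k\<le>?q. monom ((-1) ^ k * eig_sigma k B) (?q - k)"
  have "charpoly B = ?p"
    by (intro poly_eqI_degree[of UNIV] poly_ext)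
      (simp add: poly_charpoly det_eq_sum_eig_sigma poly_sum poly_monom)
  then have "coeff (charpoly B) (?q - k) = (\<Sum>j\<le>?q. if j = k then (-1) ^ j * eig_sigma j B else 0)"
    unfolding \<open>charpoly B = ?p\<close> coeff_sum coeff_monom using assms by (intro sum.cong) auto
  also have "\<dots> = (-1) ^ k * eig_sigma k B" using assms by simp
  finally show ?thesis by (simp add: mult.assoc[symmetric] power_mult_distrib[symmetric])
qed

lemma holomorphic_on_eig_sigma:
  fixes A :: "complex \<Rightarrow> complex^'q^'q"
  assumes "\<And>i j. (\<lambda>z. A z $ i $ j) holomorphic_on S" "k \<le> CARD('q)"
  shows "(\<lambda>z. eig_sigma k (A z)) holomorphic_on S"
  unfolding eig_sigma_eq_coeff_charpoly[OF assms(2)]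
  by (intro holomorphic_intros charpoly_coeff_closed[where P = "\<lambda>f. f holomorphic_on S"] assms)

lemma isCont_eig_sigma:
  fixes B :: "complex^'q^'q"
  assumes "k \<le> CARD('q)"
  shows "isCont (eig_sigma k) B"
proof -
  have "continuous_on UNIV (\<lambda>B :: complex^'q^'q. coeff (charpoly B) (CARD('q) - k))"
    by (intro charpoly_coeff_closed[where P = "continuous_on UNIV"] continuous_intros)
  then have "continuous_on UNIV (\<lambda>B :: complex^'q^'q. eig_sigma k B)"
    unfolding eig_sigma_eq_coeff_charpoly[OF assms] by (intro continuous_intros)
  then show ?thesis by (simp add: continuous_on_eq_continuous_at)
qed

lemma norm_elem_sym_le:
  fixes M :: "complex multiset"
  assumes "\<And>x. x \<in># M \<Longrightarrow> norm x \<le> b"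
  shows "norm (elem_sym k M) \<le> real (size M choose k) * b ^ k"
proof -
  let ?I = "mset_index M"
  have "?I = (SIGMA x:set_mset M. {..<count M x})"
    by (auto simp: mset_index_def count_inI)
  then have card: "card ?I = size M"
    by (simp add: card_SigmaI size_multiset_overloaded_eq)
  have "norm (elem_sym k M) \<le> (\<Sum>S | S \<subseteq> ?I \<and> card S = k. b ^ k)"
    unfolding elem_sym_def
  proof (rule sum_norm_le)
    fix S assume S: "S \<in> {S. S \<subseteq> ?I \<and> card S = k}"
    have "norm (\<Prod>s\<in>S. fst s) \<le> (\<Prod>s\<in>S. b)"
      unfolding prod_norm[symmetric]
    proof (rule prod_mono)
      fix s assume "s \<in> S"
      then have "fst s \<in># M" using S by (cases s) (auto simp: mset_index_def count_inI)
      then show "0 \<le> norm (fst s) \<and> norm (fst s) \<le> b" by (simp add: assms)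
    qed
    then show "norm (\<Prod>s\<in>S. fst s) \<le> b ^ k" using S by simp
  qed
  also have "\<dots> = real (size M choose k) * b ^ k"
    using n_subsets[OF finite_mset_index, of M k] by (simp add: card)
  finally show ?thesis .
qed

text \<open>Once \<open>det (c I - A(z)) / c\<^sup>q\<close> is bounded above, each factor \<open>1 - \<mu> / c\<close> is, because all the other
  factors are at least \<open>1 / 2\<close> in modulus.\<close>

lemma eigval_linear_growth:
  fixes A :: "complex \<Rightarrow> complex^'q^'q"
  assumes entire: "\<And>i j. (\<lambda>z. A z $ i $ j) holomorphic_on UNIV"
    and A0: "A 0 = 0" and m: "m \<ge> 0" and \<tau>: "\<tau> \<ge> 0"
    and Re: "\<And>z \<mu>. \<mu> \<in># eigvals (A z) \<Longrightarrow> Re \<mu> \<le> m + \<tau> * norm z"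
  obtains K where "K \<ge> 0" "\<And>z \<mu>. \<mu> \<in># eigvals (A z) \<Longrightarrow> norm \<mu> \<le> K * (1 + norm z)"
proof -
  let ?q = "CARD('q)"
  \<comment> \<open>Below, \<open>norm (of_real c - \<mu>)\<close> is at most
    \<open>(D - 1) * c\<close>, hence \<open>norm \<mu>\<close> is at most \<open>D * c\<close>; the
    other factor of \<open>K\<close> bounds \<open>c / (1 + norm z)\<close>.\<close>
  define D :: real where "D = 1 + 4 ^ (?q + 1) * 2 ^ (?q - 1)"
  define K where "K = D * (2 * m + 1 + 4 * \<tau>)"
  have "K \<ge> 0" using m \<tau> by (simp add: K_def D_def)
  moreover have "norm \<mu> \<le> K * (1 + norm z)" if \<mu>: "\<mu> \<in># eigvals (A z)" for z \<mu>
  proof -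
    \<comment> \<open>The point \<open>z\<close> lies in the half disc of radius
      \<open>R / 2\<close>. Over the whole disc, eigenvalues have real part at most
      \<open>(c - 1) / 2\<close>, so they stay at distance at least \<open>c / 2\<close> from
      \<open>c\<close>; the summand 1 keeps \<open>c\<close> positive.\<close>
    define R where "R = 2 * (norm z + 1)"
    define c where "c = 2 * (m + \<tau> * R) + 1"
    have R: "R > 0" "norm z \<le> R / 2" "norm z < R" by (simp_all add: R_def add_nonneg_pos)
    have c: "c > 0" using m \<tau> R by (simp add: c_def add_nonneg_pos)
    have far: "c / 2 \<le> norm (of_real c - \<nu>)" if w: "norm w < R" and \<nu>: "\<nu> \<in># eigvals (A w)" for w \<nu>
    proof -
      have "Re \<nu> \<le> m + \<tau> * R"
        using Re[OF \<nu>] mult_left_mono[OF less_imp_le[OF w] \<tau>] by linarith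
      then have "c / 2 \<le> Re (of_real c - \<nu>)" by (simp add: c_def field_simps)
      then show ?thesis using complex_Re_le_cmod order_trans by blast
    qed
    have norm_prod: "norm (\<Prod>\<nu>\<in>#M. of_real c - \<nu>) = (\<Prod>\<nu>\<in>#M. norm (of_real c - \<nu>))" for M :: "complex multiset"
      by (induction M) (simp_all add: norm_mult)
    \<comment> \<open>Submultisets are allowed because the bound is needed both for all eigenvalues
      and for those left after removing \<mu>.\<close>
    have lower: "(c / 2) ^ size M \<le> (\<Prod>\<nu>\<in>#M. norm (of_real c - \<nu>))"
      if "M \<subseteq># eigvals (A w)" "norm w < R" for M w
      using that(1)
    proof (induction M)
      case (add \<nu> M)
      have "\<nu> \<in># eigvals (A w)" using add.prems by (meson mset_subset_eqD union_single_eq_member)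
      moreover have "M \<subseteq># eigvals (A w)" using add.prems by (metis mset_subset_eq_insertD subset_mset.less_imp_le)
      ultimately show ?case
        using mult_mono[OF far[OF that(2)] add.IH] c by simp
    qed simp
    define g where "g w = det (mat (of_real c) - A w) / of_real c ^ ?q" for w
    \<comment> \<open>The modulus of \<open>g\<close> is at least \<open>(1/2) ^ CARD('q)\<close>;
      the additional factor \<open>1/2\<close> makes the lower bound strict.\<close>
    have "norm (g z) \<le> 1 / ((1/2) ^ (?q + 1)) ^ 2"
    proof (rule nonvanishing_holomorphic_bound[OF _ _ R(1) _ _ R(2)])
      have "(\<lambda>w. det (mat (of_real c) - A w)) holomorphic_on UNIV"
        unfolding det_eq_sum_eig_sigma
        by (intro holomorphic_intros holomorphic_on_eig_sigma entire) simp
      then show "g holomorphic_on ball 0 R"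
        unfolding g_def using c by (intro holomorphic_intros) (auto elim: holomorphic_on_subset)
      show "g 0 = 1" using c by (simp add: g_def A0 det_mat)
      fix w :: complex assume w: "w \<in> ball 0 R"
      have "(1 / 2) ^ (?q + 1) < (1 / 2 :: real) ^ ?q" by simp
      also have "\<dots> \<le> norm (g w)"
      proof -
        have "(c / 2) ^ ?q \<le> norm (det (mat (of_real c) - A w))"
          using lower[of "eigvals (A w)" w] w by (simp add: det_eq_prod_eigvals norm_prod size_eigvals)
        then show ?thesis
          using c by (simp add: g_def norm_divide norm_power pos_le_divide_eq power_divide)
      qed
      finally show "(1 / 2) ^ (?q + 1) < norm (g w)" .
    qed simp
    then have "norm (g z) \<le> 4 ^ (?q + 1)"
      by (simp add: power_one_over power_even_eq[symmetric] power_mult)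
    then have "(\<Prod>\<nu>\<in>#eigvals (A z). norm (of_real c - \<nu>)) \<le> 4 ^ (?q + 1) * c ^ ?q"
      using c by (simp add: g_def norm_divide norm_power det_eq_prod_eigvals norm_prod pos_divide_le_eq)
    moreover obtain M where M: "eigvals (A z) = add_mset \<mu> M" using \<mu> by (metis multi_member_split)
    ultimately have "norm (of_real c - \<mu>) * (\<Prod>\<nu>\<in>#M. norm (of_real c - \<nu>)) \<le> 4 ^ (?q + 1) * c ^ ?q"
      by simp
    moreover have sizeM: "?q = Suc (size M)" using size_eigvals[of "A z"] M by simp
    moreover have "(c / 2) ^ (?q - 1) \<le> (\<Prod>\<nu>\<in>#M. norm (of_real c - \<nu>))"
      using lower[of M z] R(3) M sizeM by simp
    ultimately have "norm (of_real c - \<mu>) * (c / 2) ^ (?q - 1) \<le> 4 ^ (?q + 1) * c ^ ?q"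
      by (meson mult_left_mono norm_ge_zero order_trans)
    also have "\<dots> = (4 ^ (?q + 1) * 2 ^ (?q - 1) * c) * (c / 2) ^ (?q - 1)"
      unfolding sizeM by (simp add: power_divide)
    finally have "norm (of_real c - \<mu>) \<le> 4 ^ (?q + 1) * 2 ^ (?q - 1) * c"
      using c by (subst (asm) mult_le_cancel_right_pos) auto
    then have "norm \<mu> \<le> D * c"
      using norm_triangle_ineq4[of "of_real c" "of_real c - \<mu>"] c by (simp add: D_def algebra_simps)
    also have "\<dots> \<le> D * ((2 * m + 1 + 4 * \<tau>) * (1 + norm z))"
      using m \<tau> by (intro mult_left_mono) (simp_all add: D_def c_def R_def algebra_simps)
    finally show ?thesis by (simp add: K_def mult.assoc)
  qed
  ultimately show ?thesis using that by blast
qed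

section \<open>From growth bounds to polynomials\<close>

lemma polynomial_growth_imp_poly:
  fixes f :: "complex \<Rightarrow> complex"
  assumes hol: "f holomorphic_on UNIV" and growth: "\<And>z. norm (f z) \<le> K * (1 + norm z) ^ n"
  obtains P :: "complex poly" where "degree P \<le> n" "\<And>z. f z = poly P z"
proof
  let ?P = "\<Sum>k\<le>n. monom ((deriv ^^ k) f 0 / fact k) k"
  have "norm (f 0) \<le> K" using growth[of 0] by simp
  then have K: "K \<ge> 0" using norm_ge_zero order_trans by blast
  show "degree ?P \<le> n"
    by (intro degree_sum_le) (auto intro: order_trans[OF degree_monom_le])
  show "f z = poly ?P z" for z
    unfolding poly_sum poly_monom
  proof (rule Liouville_polynomial[OF hol, where A = 1 and B = "K * 2 ^ n"])
    \<comment> \<open>Away from the unit disc \<open>1 + norm z\<close> is at most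
      \<open>2 * norm z\<close>, which accounts for the constant \<open>K * 2 ^ n\<close>.\<close>
    fix z :: complex assume z: "1 \<le> norm z"
    have "norm (f z) \<le> K * (1 + norm z) ^ n" by (rule growth)
    also have "\<dots> \<le> K * (2 * norm z) ^ n" using z K by (intro mult_left_mono power_mono) auto
    finally show "norm (f z) \<le> K * 2 ^ n * norm z ^ n" by (simp add: power_mult_distrib mult.assoc)
  qed
qed

lemma eig_sigma_poly:
  fixes A :: "complex \<Rightarrow> complex^'q^'q"
  assumes entire: "\<And>i j. (\<lambda>z. A z $ i $ j) holomorphic_on UNIV"
    and A0: "A 0 = 0" and N: "is_vnorm N" and C: "C \<ge> 1" and \<tau>: "\<tau> \<ge> 0"
    and growth: "\<And>z. opnorm N (matexp (A z)) \<le> C * exp (\<tau> * norm z)"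
    and k: "k \<le> CARD('q)"
  obtains P :: "complex poly" where "degree P \<le> k" "\<And>z. eig_sigma k (A z) = poly P z"
proof -
  have "Re \<mu> \<le> ln C + \<tau> * norm z" if "\<mu> \<in># eigvals (A z)" for z \<mu>
  proof -
    have "exp (Re \<mu>) \<le> C * exp (\<tau> * norm z)"
      using exp_Re_eigval_le_opnorm_matexp[OF N that] growth order_trans by blast
    also have "\<dots> = exp (ln C + \<tau> * norm z)" using C by (simp add: exp_add)
    finally show ?thesis by simp
  qed
  then obtain K where K: "K \<ge> 0" "\<And>z \<mu>. \<mu> \<in># eigvals (A z) \<Longrightarrow> norm \<mu> \<le> K * (1 + norm z)"
    using eigval_linear_growth[OF entire A0 _ \<tau>, where m = "ln C"] C by auto
  have "norm (eig_sigma k (A z)) \<le> real (CARD('q) choose k) * K ^ k * (1 + norm z) ^ k" for z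
    using norm_elem_sym_le[of "eigvals (A z)" "K * (1 + norm z)" k] K(2)
    by (simp add: eig_sigma_def size_eigvals power_mult_distrib mult.assoc)
  then show ?thesis
    using polynomial_growth_imp_poly[OF holomorphic_on_eig_sigma[OF entire k]] that by blast
qed

subsection \<open>Tangency at the origin\<close>

lemma det_mat_mult: "det (mat c ** B) = c ^ CARD('q) * det (B :: complex^'q^'q)"
  by (simp add: det_mul det_mat)

text \<open>Pulling \<open>c\<close> out of the determinant gives \<open>det (x I - c B)\<close> as
  \<open>c ^ q\<close> times the characteristic polynomial of \<open>B\<close> at
  \<open>x / c\<close>. In degree \<open>q - k\<close> this leaves the factor
  \<open>c ^ k\<close>.\<close>

lemma eig_sigma_scale:
  fixes B :: "complex^'q^'q"
  assumes k: "k \<le> CARD('q)" and c: "c \<noteq> 0"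
  shows "eig_sigma k (mat c ** B) = c ^ k * eig_sigma k B"
proof -
  let ?q = "CARD('q)"
  have "poly (charpoly (mat c ** B)) x = poly (smult (c ^ ?q) (charpoly B \<circ>\<^sub>p [:0, inverse c:])) x" for x
  proof -
    have "mat x - mat c ** B = mat c ** (mat (x / c) - B)"
      unfolding vec_eq_iff vector_minus_component mat_matrix_mult_nth
      using c by (simp add: mat_def right_diff_distrib)
    then show ?thesis
      by (simp add: poly_charpoly poly_pcompose det_mat_mult divide_inverse)
  qed
  then have eq: "charpoly (mat c ** B) = smult (c ^ ?q) (charpoly B \<circ>\<^sub>p [:0, inverse c:])"
    by (intro poly_ext) simp
  have "eig_sigma k (mat c ** B) =
      (-1) ^ k * coeff (charpoly B) (?q - k) * (c ^ ?q * inverse c ^ (?q - k))"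
    using k by (simp add: eig_sigma_eq_coeff_charpoly eq coeff_pcompose_linear mult_ac)
  also have "c ^ ?q * inverse c ^ (?q - k) = c ^ k"
    using k c by (simp add: power_diff power_inverse)
  finally show ?thesis
    using k by (simp add: eig_sigma_eq_coeff_charpoly mult_ac)
qed

text \<open>If the difference \<open>Q\<close> were nonzero, its order \<open>n\<close> at 0 would
  be at most its degree, hence at most \<open>k\<close>. Then \<open>Q\<close> divided by
  \<open>z ^ n\<close> would tend to 0, although the cofactor \<open>S\<close> does not vanish at
  0.\<close>

lemma poly_eq_monom_if_tendsto:
  fixes P :: "complex poly"
  assumes deg: "degree P \<le> k" and eq: "\<And>z. z \<noteq> 0 \<Longrightarrow> poly P z = z ^ k * \<phi> z"
    and lim: "(\<phi> \<longlongrightarrow> c) (at 0)"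
  shows "P = monom c k"
proof (rule ccontr)
  assume "P \<noteq> monom c k"
  define Q where "Q = P - monom c k"
  define n where "n = order 0 Q"
  have Q: "Q \<noteq> 0" using \<open>P \<noteq> monom c k\<close> by (simp add: Q_def)
  have "degree Q \<le> k"
    unfolding Q_def by (intro degree_diff_le deg degree_monom_le)
  then have n: "n \<le> k" using order_degree[OF Q, of 0] by (simp add: n_def)
  obtain S where S: "Q = [:- 0, 1:] ^ n * S" "\<not> [:- 0, 1:] dvd S"
    using order_decomp[OF Q, of 0] n_def by blast
  have "poly S 0 \<noteq> 0" using S(2) by (simp add: poly_eq_0_iff_dvd)
  have "poly S z = z ^ (k - n) * (\<phi> z - c)" if "z \<noteq> 0" for z
  proof -
    have "z ^ n * poly S z = poly Q z" by (simp add: S(1) poly_power)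
    also have "\<dots> = z ^ k * (\<phi> z - c)" using eq[OF that] by (simp add: Q_def poly_monom algebra_simps)
    also have "\<dots> = z ^ n * (z ^ (k - n) * (\<phi> z - c))"
      using n by (simp add: mult.assoc[symmetric] power_add[symmetric])
    finally show ?thesis using that by simp
  qed
  then have "\<forall>\<^sub>F z in at 0. z ^ (k - n) * (\<phi> z - c) = poly S z"
    by (simp add: eventually_at_filter)
  \<comment> \<open>For \<open>n = k\<close> the power equals 1, and the limit vanishes because of
    the factor \<open>c - c\<close>.\<close>
  moreover have "((\<lambda>z. z ^ (k - n) * (\<phi> z - c)) \<longlongrightarrow> 0 ^ (k - n) * (c - c)) (at 0)"
    by (intro tendsto_intros lim)
  ultimately have "(poly S \<longlongrightarrow> 0) (at 0)"
    using tendsto_cong by fastforce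
  moreover have "(poly S \<longlongrightarrow> poly S 0) (at 0)"
    using poly_isCont[of 0 S] by (simp add: isCont_def)
  ultimately show False
    using \<open>poly S 0 \<noteq> 0\<close> tendsto_unique[of "at (0::complex)"] by fastforce
qed

lemma tendsto_quotient_if_bigo:
  fixes A :: "complex \<Rightarrow> complex^'q^'q"
  assumes "(\<lambda>z. norm (A z - mat z ** H)) \<in> O[at 0](\<lambda>z. norm (z ^ 2))"
  shows "((\<lambda>z. mat (inverse z) ** A z) \<longlongrightarrow> H) (at 0)"
proof (intro vec_tendstoI)
  fix i j
  obtain c where c: "\<forall>\<^sub>F z in at 0. norm (A z - mat z ** H) \<le> c * norm z ^ 2"
    using landau_o.bigE[OF assms] by (auto simp: norm_power)
  have "((\<lambda>z. (mat (inverse z) ** A z) $ i $ j - H $ i $ j) \<longlongrightarrow> 0) (at 0)"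
  proof (rule Lim_null_comparison)
    show "\<forall>\<^sub>F z in at 0. norm ((mat (inverse z) ** A z) $ i $ j - H $ i $ j) \<le> c * norm z"
      using c eventually_neq_at_within[of 0 0]
    proof eventually_elim
      case (elim z)
      have "norm ((A z - mat z ** H) $ i $ j) \<le> norm (A z - mat z ** H)"
        by (meson Finite_Cartesian_Product.norm_nth_le order_trans)
      then have "norm (A z $ i $ j - z * H $ i $ j) \<le> c * norm z ^ 2"
        using elim by (simp add: mat_matrix_mult_nth)
      moreover have "(mat (inverse z) ** A z) $ i $ j - H $ i $ j = (A z $ i $ j - z * H $ i $ j) / z"
        using elim by (simp add: mat_matrix_mult_nth field_simps)
      ultimately show ?case
        using elim by (simp add: norm_divide divide_le_eq power2_eq_square mult.assoc)
    qed
    show "((\<lambda>z. c * norm z) \<longlongrightarrow> 0) (at 0)"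
      by (intro tendsto_eq_intros) auto
  qed
  then show "((\<lambda>z. (mat (inverse z) ** A z) $ i $ j) \<longlongrightarrow> H $ i $ j) (at 0)"
    by (simp add: LIM_zero_iff)
qed

lemma det_eq_if_tangent:
  fixes A :: "complex \<Rightarrow> complex^'q^'q"
  assumes A0: "A 0 = 0"
    and poly: "\<And>k. k \<le> CARD('q) \<Longrightarrow>
      \<exists>P :: complex poly. degree P \<le> k \<and> (\<forall>z. eig_sigma k (A z) = poly P z)"
    and tangent: "(\<lambda>z. norm (A z - mat z ** H)) \<in> O[at 0](\<lambda>z. norm (z ^ 2))"
  shows "det (mat \<zeta> - A z) = det (mat \<zeta> - mat z ** H)"
proof (cases "z = 0")
  case False
  have "eig_sigma k (A z) = eig_sigma k (mat z ** H)" if k: "k \<le> CARD('q)" for k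
  proof -
    obtain P :: "complex poly" where P: "degree P \<le> k" "\<And>z. eig_sigma k (A z) = poly P z"
      using poly[OF k] by blast
    \<comment> \<open>By homogeneity \<open>?\<phi>\<close> is the quotient of \<open>P\<close> by
      the \<open>k\<close>th power, and continuity of \<open>eig_sigma k\<close> identifies its
      limit at 0.\<close>
    let ?\<phi> = "\<lambda>z. eig_sigma k (mat (inverse z) ** A z)"
    have "poly P w = w ^ k * ?\<phi> w" if "w \<noteq> 0" for w
    proof -
      have "A w = mat w ** (mat (inverse w) ** A w)"
        using that by (simp add: vec_eq_iff mat_matrix_mult_nth)
      then show ?thesis using eig_sigma_scale[OF k that] P(2)[of w] by metis
    qed
    moreover have "(?\<phi> \<longlongrightarrow> eig_sigma k H) (at 0)"
      by (rule isCont_tendsto_compose[OF isCont_eig_sigma[OF k] tendsto_quotient_if_bigo[OF tangent]])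
    ultimately have "P = monom (eig_sigma k H) k"
      by (rule poly_eq_monom_if_tendsto[OF P(1)])
    then show ?thesis by (simp add: P(2) poly_monom eig_sigma_scale[OF k False] mult.commute)
  qed
  then show ?thesis by (simp add: det_eq_sum_eig_sigma)
qed (simp add: A0)

subsection \<open>Traces of powers\<close>

text \<open>Evaluation of a polynomial at a matrix goes through \<open>matpow\<close> and scalar
  matrices, since the product and power of the matrix type are entrywise.\<close>

definition matpoly :: "complex poly \<Rightarrow> complex^'q^'q \<Rightarrow> complex^'q^'q" where
  "matpoly p B = (\<Sum>i\<le>degree p. mat (coeff p i) ** matpow B i)"

lemma matpoly_altdef:
  assumes "degree p \<le> n"
  shows "matpoly p B = (\<Sum>i\<le>n. mat (coeff p i) ** matpow B i)"
  unfolding matpoly_def using assms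
  by (intro sum.mono_neutral_left) (auto simp: coeff_eq_0)

lemma mat_matrix_mult_commute: "mat c ** M = M ** (mat c :: 'a::comm_ring_1^'n^'n)"
  by (simp add: vec_eq_iff mat_matrix_mult_nth matrix_mat_mult_nth mult.commute)

text \<open>Peeling off linear factors turns a factored polynomial into a matrix product, to which
  multiplicativity of \<open>det\<close> applies.\<close>

lemma matpoly_linear_mult: "matpoly ([:- r, 1:] * p) B = (B - mat r) ** matpoly p B"
proof -
  let ?n = "degree p"
  let ?S = "\<Sum>i\<le>?n. mat (coeff p i) ** matpow B i"
  have mult_sum: "M ** (\<Sum>i\<in>I. f i) = (\<Sum>i\<in>I. M ** f i)" if "finite I" for M :: "complex^'q^'q" and I and f :: "nat \<Rightarrow> complex^'q^'q"
    using that by induction (simp_all add: matrix_add_ldistrib)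
  have add: "mat (a + b) ** M = mat a ** M + mat b ** M" for a b and M :: "complex^'q^'q"
    by (simp add: vec_eq_iff mat_matrix_mult_nth algebra_simps)
  have "degree ([:- r, 1:] * p) \<le> Suc ?n"
    using degree_mult_le[of "[:- r, 1:]" p] by simp
  then have "matpoly ([:- r, 1:] * p) B = (\<Sum>i\<le>Suc ?n. mat (coeff ([:- r, 1:] * p) i) ** matpow B i)"
    by (rule matpoly_altdef)
  also have "\<dots> = (\<Sum>i\<le>Suc ?n. mat (coeff (pCons 0 p) i) ** matpow B i) +
      (\<Sum>i\<le>Suc ?n. mat (- r * coeff p i) ** matpow B i)"
  proof -
    have "coeff ([:- r, 1:] * p) i = coeff (pCons 0 p) i + - r * coeff p i" for i by simp
    then show ?thesis by (simp only: add sum.distrib)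
  qed
  also have "(\<Sum>i\<le>Suc ?n. mat (coeff (pCons 0 p) i) ** matpow B i) = B ** ?S"
    by (subst sum.atMost_Suc_shift)
      (simp add: mult_sum matrix_mul_assoc mat_matrix_mult_commute[of _ B])
  \<comment> \<open>The top summand is zero, because \<open>Suc ?n\<close> exceeds the degree of
    \<open>p\<close>.\<close>
  also have "(\<Sum>i\<le>Suc ?n. mat (- r * coeff p i) ** matpow B i) = - (mat r ** ?S)"
    by (simp add: mult_sum coeff_eq_0 vec_eq_iff mat_matrix_mult_nth sum_negf mult.assoc)
  finally show ?thesis
    by (simp add: matpoly_def vec_eq_iff matrix_matrix_mult_def left_diff_distrib sum_subtractf)
qed

lemma det_matpoly_prod:
  fixes B :: "complex^'q^'q"
  shows "det (matpoly (\<Prod>r\<in>#R. [:- r, 1:]) B) = (\<Prod>r\<in>#R. det (B - mat r))"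
proof (induction R)
  case empty
  have "matpoly 1 B = mat 1" by (simp add: matpoly_def)
  then show ?case by simp
next
  case (add r R)
  then show ?case by (simp add: matpoly_linear_mult det_mul del: mult_pCons_left)
qed

lemma det_matrix_minus_mat:
  "det (B - mat r) = (-1) ^ CARD('q) * det (mat r - B)" for B :: "complex^'q^'q"
proof -
  have "B - mat r = mat (-1) ** (mat r - B)" by (simp add: vec_eq_iff mat_matrix_mult_nth)
  then show ?thesis by (simp add: det_mat_mult)
qed

text \<open>Each \<open>det (B - mat r)\<close> is, up to a sign depending only on the dimension,
  the value of \<open>charpoly B\<close> at \<open>r\<close>. Hence the factorisation of
  \<open>det (matpow B p - mat c)\<close> sees \<open>B\<close> only through
  \<open>charpoly B\<close>.\<close>

lemma charpoly_matpow_cong: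
  fixes B B' :: "complex^'q^'q"
  assumes eq: "charpoly B = charpoly B'" and p: "p \<ge> 1"
  shows "charpoly (matpow B p) = charpoly (matpow B' p)"
proof (rule poly_ext)
  fix c :: complex
  define X where "X = monom 1 p + [:- c:]"
  have deg: "degree X = p"
    using p degree_add_eq_left[of "[:- c:]" "monom 1 p"] by (simp add: X_def degree_monom_eq)
  have "lead_coeff X = 1" unfolding deg using p by (simp add: X_def coeff_pCons split: nat.split)
  then have X: "X = (\<Prod>r\<in>#proots X. [:- r, 1:])"
    using complex_poly_decompose_multiset[of X] by simp
  have "matpoly X M = matpow M p - mat c" for M :: "complex^'q^'q"
  proof -
    have mat_entry: "c * mat 1 $ i $ j = (mat c :: complex^'q^'q) $ i $ j" for i j
      by (simp add: mat_def)
    \<comment> \<open>Only the indices \<open>p\<close> and 0 contribute, and they differ because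
      \<open>p\<close> is at least 1.\<close>
    have "matpoly X M = (\<Sum>i\<le>p. (if i = p then matpow M p else 0) - (if i = 0 then mat c else 0))"
      unfolding matpoly_def deg using p
      by (intro sum.cong)
        (auto simp: X_def coeff_pCons vec_eq_iff mat_matrix_mult_nth mat_entry split: nat.split)
    then show ?thesis by (simp add: sum_subtractf)
  qed
  then have "det (matpow M p - mat c) = (\<Prod>r\<in>#proots X. det (M - mat r))" for M :: "complex^'q^'q"
    using det_matpoly_prod[of "proots X" M] X by simp
  then have "det (matpow B p - mat c) = det (matpow B' p - mat c)"
    by (simp add: det_matrix_minus_mat eq flip: poly_charpoly)
  then show "poly (charpoly (matpow B p)) c = poly (charpoly (matpow B' p)) c"
    by (simp add: det_matrix_minus_mat poly_charpoly)
qed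

section \<open>The trace as a coefficient of the characteristic polynomial\<close>

lemma coeff_prod_linear:
  fixes b :: "'i \<Rightarrow> complex"
  assumes "finite I" "card I = Suc n"
  shows "coeff (\<Prod>i\<in>I. [:- b i, 1:]) n = - (\<Sum>i\<in>I. b i)"
  using assms
proof (induction I arbitrary: n)
  case (insert i I)
  then have n: "card I = n" by simp
  have deg: "degree (\<Prod>i\<in>I. [:- b i, 1:]) = n"
    using n by (subst degree_prod_eq_sum_degree) auto
  have lead: "coeff (\<Prod>i\<in>I. [:- b i, 1:]) n = 1"
    using lead_coeff_prod[of "\<lambda>i. [:- b i, 1:]" I] by (simp add: deg)
  show ?case
  proof (cases n)
    case 0
    then have "I = {}" using n insert by simp
    then show ?thesis using 0 by simp
  next
    case (Suc m)
    then show ?thesis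
      using insert lead insert.IH[of m] n by (simp add: coeff_pCons)
  qed
qed simp

text \<open>A permutation other than the identity moves at least two indices, so its term in the
  determinant has degree at most \<open>CARD('q) - 2\<close>. Only the diagonal product reaches the
  coefficient in question.\<close>

lemma coeff_charpoly_trace:
  fixes B :: "complex^'q^'q"
  shows "coeff (charpoly B) (CARD('q) - 1) = - trace B"
proof -
  let ?e = "\<lambda>i j. (if i = j then [:0, 1:] else 0) - [:B $ i $ j:]"
  let ?t = "\<lambda>p. of_int (sign p) * (\<Prod>i\<in>UNIV. ?e i (p i))"
  let ?P = "{p. p permutes (UNIV :: 'q set)}"
  have off: "coeff (?t p) (CARD('q) - 1) = 0" if p: "p \<in> ?P - {id}" for p
  proof -
    obtain i where i: "p i \<noteq> i" using p by (metis DiffD2 eq_id_iff singletonI)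
    \<comment> \<open>Injectivity of \<open>p\<close> makes \<open>p i\<close> a second moved
      index.\<close>
    have pi: "p (p i) \<noteq> p i" using i p by (metis DiffD1 mem_Collect_eq permutes_def)
    have two: "2 \<le> CARD('q)" using card_mono[of UNIV "{i, p i}"] i by simp
    have "degree (?t p) \<le> degree (\<Prod>i\<in>UNIV. ?e i (p i))"
      by (rule order_trans[OF degree_mult_le]) (simp add: of_int_poly)
    also have "\<dots> \<le> (\<Sum>i\<in>UNIV. degree (?e i (p i)))"
      using degree_prod_sum_le[of UNIV "\<lambda>i. ?e i (p i)"] by (simp add: o_def)
    also have "\<dots> \<le> (\<Sum>j\<in>UNIV. if j \<in> UNIV - {i, p i} then 1 else 0)"
      using i pi by (intro sum_mono) auto
    also have "\<dots> = card (UNIV - {i, p i})"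
      by (subst sum.inter_restrict[symmetric]) auto
    also have "\<dots> = CARD('q) - 2" using i by (simp add: card_Diff_subset)
    finally show ?thesis using two by (intro coeff_eq_0) linarith
  qed
  have "charpoly B = ?t id + (\<Sum>p\<in>?P - {id}. ?t p)"
    unfolding charpoly_def det_def
    by (subst sum.remove[of _ id]) (auto simp: permutes_id intro!: sum.cong)
  then have "coeff (charpoly B) (CARD('q) - 1) =
      coeff (?t id) (CARD('q) - 1) + (\<Sum>p\<in>?P - {id}. coeff (?t p) (CARD('q) - 1))"
    by (simp only: coeff_add coeff_sum)
  also have "(\<Sum>p\<in>?P - {id}. coeff (?t p) (CARD('q) - 1)) = 0" using off by (intro sum.neutral) blast
  also have "?t id = (\<Prod>i\<in>UNIV. [:- B $ i $ i, 1:])" by (simp add: sign_id)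
  also have "coeff \<dots> (CARD('q) - 1) = - (\<Sum>i\<in>UNIV. B $ i $ i)"
    by (rule coeff_prod_linear) simp_all
  finally show ?thesis by (simp add: trace_def)
qed

lemma trace_matpow_cong:
  fixes B B' :: "complex^'q^'q"
  assumes "charpoly B = charpoly B'" "p \<ge> 1"
  shows "trace (matpow B p) = trace (matpow B' p)"
  using charpoly_matpow_cong[OF assms] coeff_charpoly_trace[of "matpow B p"]
    coeff_charpoly_trace[of "matpow B' p"] by simp

lemma trace_matpow_scale:
  fixes H :: "complex^'q^'q"
  shows "trace (matpow (mat z ** H) p) = z ^ p * trace (matpow H p)"
proof -
  have "matpow (mat z ** H) p = mat (z ^ p) ** matpow H p"
  proof (induction p)
    case (Suc p)
    have "matpow (mat z ** H) (Suc p) = mat z ** (H ** mat (z ^ p)) ** matpow H p"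
      by (simp add: Suc matrix_mul_assoc)
    also have "H ** mat (z ^ p) = mat (z ^ p) ** H" by (rule mat_matrix_mult_commute[symmetric])
    also have "mat z ** (mat (z ^ p) ** H) ** matpow H p = (mat z ** mat (z ^ p)) ** (H ** matpow H p)"
      by (simp only: matrix_mul_assoc)
    also have "mat z ** mat (z ^ p) = (mat (z ^ Suc p) :: complex^'q^'q)"
      by (simp add: vec_eq_iff mat_matrix_mult_nth) (simp add: mat_def)
    finally show ?case by simp
  qed simp
  then show ?thesis by (simp add: trace_def mat_matrix_mult_nth sum_distrib_left)
qed

theorem theorem1p3:
  fixes A :: "complex \<Rightarrow> complex^'q^'q" and N :: "complex^'q \<Rightarrow> real" and C \<tau> :: real
  assumes entire: "\<And>i j. (\<lambda>z. A z $ i $ j) holomorphic_on UNIV"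
    and A0: "A 0 = 0"
    and N: "is_vnorm N"
    and C: "C \<ge> 1" and \<tau>: "\<tau> \<ge> 0"
    and growth: "\<And>z. opnorm N (matexp (A z)) \<le> C * exp (\<tau> * norm z)"
  shows "(\<forall>k. 1 \<le> k \<and> k \<le> CARD('q) \<longrightarrow>
            (\<exists>P :: complex poly. degree P \<le> k \<and> (\<forall>z. eig_sigma k (A z) = poly P z))) \<and>
         (\<forall>H :: complex^'q^'q.
            (\<lambda>z. norm (A z - mat z ** H)) \<in> O[at 0](\<lambda>z. norm (z ^ 2)) \<longrightarrow>
              (\<forall>z \<zeta>. det (mat \<zeta> - A z) = det (mat \<zeta> - mat z ** H)) \<and>
              (\<forall>p z. 1 \<le> p \<longrightarrow> trace (matpow (A z) p) = z ^ p * trace (matpow H p)))"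
proof (intro conjI allI impI)
  \<comment> \<open>The case \<open>k = 0\<close> is included because
    \<open>det_eq_if_tangent\<close> compares all terms of
    \<open>det_eq_sum_eig_sigma\<close>.\<close>
  have poly: "\<exists>P :: complex poly. degree P \<le> k \<and> (\<forall>z. eig_sigma k (A z) = poly P z)"
    if "k \<le> CARD('q)" for k
    using eig_sigma_poly[OF entire A0 N C \<tau> growth that] by metis
  then show "\<exists>P :: complex poly. degree P \<le> k \<and> (\<forall>z. eig_sigma k (A z) = poly P z)"
    if "1 \<le> k \<and> k \<le> CARD('q)" for k
    using that by blast
  fix H :: "complex^'q^'q"
  assume tangent: "(\<lambda>z. norm (A z - mat z ** H)) \<in> O[at 0](\<lambda>z. norm (z ^ 2))"
  show det: "det (mat \<zeta> - A z) = det (mat \<zeta> - mat z ** H)" for z \<zeta>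
    by (rule det_eq_if_tangent[OF A0 poly tangent])
  fix p :: nat and z
  assume p: "1 \<le> p"
  have "charpoly (A z) = charpoly (mat z ** H)"
    by (intro poly_ext) (simp add: poly_charpoly det)
  then show "trace (matpow (A z) p) = z ^ p * trace (matpow H p)"
    using trace_matpow_cong[OF _ p] trace_matpow_scale by metis
qed

end
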